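(* For every integer $n\ge1$, let $$Q_n=\begin{bmatrix}F_n+hF_{n+2} & (F_{n+1}-F_{n+2})+hF_{n+3}\\ (F_{n+2}-F_{n+1})+hF_{n+3} & F_n-hF_{n+2}\end{bmatrix}$$ be the hybrid Fibonacci spinor matrix. Then $$\det(Q_n)=-F_{2n+5}+2F_n^2 .$$
   Context: $h$ is the hyperbolic unit: $h^2=1$, $h\notin\mathbb{R}$, so matrix entries lie in the commutative ring of hyperbolic (split-complex) numbers $\{a+hb: a,b\in\mathbb{R}\}\cong\mathbb{R}[h]/(h^2-1)$. $F_n$ is the Fibonacci sequence: $F_0=0$, $F_1=1$, $F_{n+1}=F_n+F_{n-1}$. *)

theory Defs
  imports "HOL-Analysis.Determinants" "HOL-Number_Theory.Fib"
begin

text \<open>Hyperbolic (split-complex) numbers: \<open>Hyp a b\<close> represents \<open>a + h b\<close>.\<close>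

datatype hyp = Hyp (real_part: real) (hyp_part: real)

lemma hyp_eq_iff: "x = y \<longleftrightarrow> real_part x = real_part y \<and> hyp_part x = hyp_part y"
  by (auto intro: hyp.expand)

instantiation hyp :: "{comm_ring_1, real_algebra_1}"
begin

definition "0 = Hyp 0 0"
definition "1 = Hyp 1 0"
definition "x + y = Hyp (real_part x + real_part y) (hyp_part x + hyp_part y)"
definition "- x = Hyp (- real_part x) (- hyp_part x)"
definition "x - y = Hyp (real_part x - real_part y) (hyp_part x - hyp_part y)"
definition "x * y = Hyp (real_part x * real_part y + hyp_part x * hyp_part y)
                        (real_part x * hyp_part y + hyp_part x * real_part y)"
definition "r *\<^sub>R x = Hyp (r * real_part x) (r * hyp_part x)"

instance
  by standard
    (simp_all add: hyp_eq_iff zero_hyp_def one_hyp_def plus_hyp_def uminus_hyp_def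
      minus_hyp_def times_hyp_def scaleR_hyp_def algebra_simps)

end

definition hyp_unit :: hyp where
  "hyp_unit = Hyp 0 1"

lemma hyp_unit_square: "hyp_unit\<^sup>2 = 1"
  by (simp add: hyp_unit_def power2_eq_square times_hyp_def one_hyp_def)

lemma of_real_hyp: "of_real r = Hyp r 0"
  by (simp add: of_real_def scaleR_hyp_def one_hyp_def)

lemma hyp_unit_not_real: "hyp_unit \<notin> \<real>"
  by (auto simp: Reals_def of_real_hyp hyp_unit_def)

lemma Hyp_eq: "Hyp a b = of_real a + hyp_unit * of_real b"
  by (simp add: of_real_hyp hyp_unit_def plus_hyp_def times_hyp_def)

text \<open>
  The Fibonacci numbers are embedded into the hyperbolic numbers before they are subtracted,
  so the differences are not truncated. The inner vectors are the rows of the matrix.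
\<close>

definition fib_spinor_matrix :: "nat \<Rightarrow> hyp^2^2" where
  "fib_spinor_matrix n = (let F = (\<lambda>k. of_nat (fib k)); h = hyp_unit in
     vector
       [vector [F n + h * F (n + 2), (F (n + 1) - F (n + 2)) + h * F (n + 3)],
        vector [(F (n + 2) - F (n + 1)) + h * F (n + 3), F n - h * F (n + 2)]])"

end

theory Submission imports Defs begin

text \<open>Both the diagonal and the antidiagonal product are differences of squares, since each
  pairs conjugate factors up to sign. With \<open>h^2 = 1\<close> and
  \<open>F (n+2) - F (n+1) = F n\<close>, the real squares give \<open>2 * (F n)^2\<close>, and the
  squares carrying \<open>h^2\<close> add up to an odd-indexed Fibonacci number by
  \<open>fib_odd_index\<close>, the addition formula at equal indices.\<close>

lemma fib_odd_index: "fib (2 * n + 1) = (fib (n + 1))\<^sup>2 + (fib n)\<^sup>2"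
  using fib_add[of n n] by (simp add: power2_eq_square mult_2)

theorem theorem4p5:
  fixes n :: nat
  assumes "n \<ge> 1"
  shows "det (fib_spinor_matrix n) = - of_nat (fib (2 * n + 5)) + 2 * (of_nat (fib n))\<^sup>2"
proof -
  define F :: "nat \<Rightarrow> hyp" where "F k = of_nat (fib k)" for k
  have diff: "F (n + 2) - F (n + 1) = F n"
    by (simp add: F_def numeral_2_eq_2)
  have "2 * (n + 2) + 1 = 2 * n + 5" "n + 2 + 1 = n + 3"
    by simp_all
  then have "fib (2 * n + 5) = (fib (n + 3))\<^sup>2 + (fib (n + 2))\<^sup>2"
    using fib_odd_index[of "n + 2"] by metis
  then have odd: "F (2 * n + 5) = (F (n + 3))\<^sup>2 + (F (n + 2))\<^sup>2"
    by (simp add: F_def)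
  have "det (fib_spinor_matrix n) =
      (F n + hyp_unit * F (n + 2)) * (F n - hyp_unit * F (n + 2))
      - ((F (n + 1) - F (n + 2)) + hyp_unit * F (n + 3)) * ((F (n + 2) - F (n + 1)) + hyp_unit * F (n + 3))"
    by (simp only: fib_spinor_matrix_def Let_def det_2 vector_2 F_def)
  \<comment> \<open>Commutativity cancels the cross terms; \<open>hyp_unit\<close> stays symbolic,
    so its square can be replaced by 1 afterwards.\<close>
  also have "\<dots> = (F n)\<^sup>2 + (F (n + 2) - F (n + 1))\<^sup>2
      - hyp_unit\<^sup>2 * ((F (n + 2))\<^sup>2 + (F (n + 3))\<^sup>2)"
    by (simp add: power2_eq_square algebra_simps)
  also have "\<dots> = 2 * (F n)\<^sup>2 - ((F (n + 3))\<^sup>2 + (F (n + 2))\<^sup>2)"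
    unfolding diff hyp_unit_square by simp
  finally show ?thesis
    unfolding odd[symmetric] by (simp add: F_def)
qed

end
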